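(* (a) For all integers $n \geq 2$, $(47n+140)/176 \leq p_{5,16}(f_{5,0}(n)) \leq (15n-11)/4$. The lower bound is attained precisely when $(n)_{16} \in d_{11}^{\,*}\, d_{12}$, and the upper bound precisely when $(n)_{16} \in \{1,5\} \cup 4\,4^*\,5$. (b) For all integers $n \geq 2$, $\big((47n+140)/176\big)^{\frac{\log 5}{\log 16}} \leq f_{5,0}(n) \leq \big((225n-165)/16\big)^{\frac{\log 5}{\log 16}}$.
   Context: Let $t(n)$ be the number of $1$'s in the base-$2$ representation of $n$, taken modulo $2$. Define $f_{5,0}(n) = \sum_{0 \leq i < n} (-1)^{t(5i)}$ for $n \geq 0$. For an integer $c \geq 2$, $(n)_c$ is the base-$c$ representation of $n\ge0$ (most significant digit first, no leading zeros), a word over digits $\{0,\ldots,c-1\}$; for a digit word $x = a_1\cdots a_t$, $[x]_c = \sum_{i=1}^t a_i c^{t-i}$. Define $p_{5,16}(m) = [(m)_5]_{16}$ for $m \geq 0$. In the regular expressions, $d_{11}$ and $d_{12}$ denote the single base-16 digits with values $11$ and $12$, the symbols $1,4,5$ denote single base-16 digits, $^*$ is Kleene star and juxtaposition is concatenation. *)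

theory Defs
  imports Complex_Main
begin

(* Words are lists of digits, most significant digit first.  Zero is represented by the
   empty word; the guard on the base only serves termination. *)
fun base_rep :: "nat \<Rightarrow> nat \<Rightarrow> nat list" where
  "base_rep c n = (if c < 2 \<or> n = 0 then [] else base_rep c (n div c) @ [n mod c])"

declare base_rep.simps [simp del]

definition base_val :: "nat \<Rightarrow> nat list \<Rightarrow> nat" where
  "base_val c w = (\<Sum>i<length w. w ! i * c ^ (length w - Suc i))"

definition t :: "nat \<Rightarrow> nat" where
  "t n = count_list (base_rep 2 n) 1 mod 2"

definition f_5_0 :: "nat \<Rightarrow> int" where
  "f_5_0 n = (\<Sum>i<n. (-1) ^ t (5 * i))"

definition p_5_16 :: "nat \<Rightarrow> nat" where
  "p_5_16 m = base_val 16 (base_rep 5 m)"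

definition conc :: "'a list set \<Rightarrow> 'a list set \<Rightarrow> 'a list set" (infixr "\<cdot>" 75) where
  "A \<cdot> B = {u @ v | u v. u \<in> A \<and> v \<in> B}"

definition star :: "'a list set \<Rightarrow> 'a list set" where
  "star A = {concat ws | ws. set ws \<subseteq> A}"

lemma base_rep_digit_less:
  assumes "2 \<le> c" and "d \<in> set (base_rep c n)"
  shows "d < c"
  using assms
proof (induction c n rule: base_rep.induct)
  case (1 c n)
  then show ?case by (cases "n = 0") (auto simp: base_rep.simps[of c n] base_rep.simps[of c 0])
qed

lemma base_rep_no_leading_zero:
  assumes "2 \<le> c" and "0 < n"
  shows "base_rep c n \<noteq> [] \<and> hd (base_rep c n) \<noteq> 0"
  using assms
proof (induction c n rule: base_rep.induct)
  case (1 c n)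
  show ?case
  proof (cases "n div c = 0")
    case True
    then have "n mod c = n" using 1 by (simp add: div_eq_0_iff)
    then show ?thesis using 1 True by (simp add: base_rep.simps[of c n] base_rep.simps[of c 0])
  next
    case False
    then have "base_rep c (n div c) \<noteq> [] \<and> hd (base_rep c (n div c)) \<noteq> 0"
      using 1 by simp
    then show ?thesis using 1 by (simp add: base_rep.simps[of c n])
  qed
qed

lemma base_val_snoc: "base_val c (w @ [d]) = c * base_val c w + d"
proof -
  have "(\<Sum>i<length w. (w @ [d]) ! i * c ^ (length w - i))
      = (\<Sum>i<length w. c * (w ! i * c ^ (length w - Suc i)))"
    by (rule sum.cong) (auto simp: nth_append Suc_diff_Suc simp flip: power_Suc)
  then show ?thesis by (simp add: base_val_def sum_distrib_left)
qed

lemma base_val_base_rep: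
  assumes "2 \<le> c"
  shows "base_val c (base_rep c n) = n"
  using assms
proof (induction c n rule: base_rep.induct)
  case (1 c n)
  show ?case
  proof (cases "n = 0")
    case True
    then show ?thesis by (simp add: base_rep.simps[of c 0] base_val_def)
  next
    case False
    then show ?thesis using 1 by (simp add: base_rep.simps[of c n] base_val_snoc)
  qed
qed

end

theory Submission
  imports Defs "HOL-Analysis.Convex"
begin

text \<open>
  Since \<open>5 (16 n + i) = 16 (5 n + \<lfloor>5 i / 16\<rfloor>) + (5 i mod 16)\<close>, the values of \<open>f\<close> on the block
  \<open>16 n, \<dots>, 16 n + 16\<close> are \<open>5 f(n)\<close> plus offsets that depend only on \<open>n\<close> modulo 8 and two
  Thue-Morse signs. The offsets lie in \<open>{0..7}\<close> if \<open>f(n + 1) = f(n) + 1\<close> and in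
  \<open>{-7..0}\<close> if \<open>f(n + 1) = f(n) - 1\<close>, so up to one borrow they are the last base-5 digit of
  \<open>f(16 n + r)\<close>, with \<open>f(n)\<close> or \<open>f(n + 1)\<close> as leading part. Both linear bounds on \<open>p(f(n))\<close> then
  follow by induction on blocks. For the lower bound one strengthens the induction by a bound on
  \<open>p(f(n) - 1)\<close>, which handles the offsets -6 and -7.

  The power bounds follow from \<open>p(m) \<le> m\<^sup>\<alpha> \<le> (15/4) p(m)\<close>, where \<open>5\<^sup>\<alpha> = 16\<close>.
\<close>

subsection \<open>The Thue-Morse sign and the block structure of the sum\<close>

definition eps :: "nat \<Rightarrow> int" where "eps n = (-1) ^ t n"

lemma eps_double: "eps (2 * n) = eps n"
  by (cases "n = 0") (simp_all add: eps_def t_def base_rep.simps[of 2 "2 * n"] base_rep.simps[of 2 0])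

lemma eps_double_plus_1: "eps (2 * n + 1) = - eps n"
proof -
  have "base_rep 2 (Suc (2 * n)) = base_rep 2 n @ [1]" by (simp add: base_rep.simps[of 2 "Suc (2 * n)"])
  then show ?thesis by (simp add: eps_def t_def minus_one_power_iff)
qed

lemma eps_0: "eps 0 = 1" by (simp add: eps_def t_def base_rep.simps[of 2 0])

lemma eps_numeral [simp]:
  "eps 0 = 1" "eps 1 = -1" "eps (Suc 0) = -1"
  "eps (numeral (num.Bit0 k)) = eps (numeral k)" "eps (numeral (num.Bit1 k)) = - eps (numeral k)"
  using eps_double[of "numeral k"] eps_double_plus_1[of "numeral k"] eps_double_plus_1[of 0] eps_0
  by (simp_all flip: numeral_Bit0_eq_double add: numeral_Bit1)

text \<open>Counts of 1's add under concatenation of binary words, and padding \<open>k\<close> with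
  leading zeros to \<open>l\<close> bits adds none.\<close>

lemma eps_append:
  assumes "k < 2 ^ l"
  shows "eps (2 ^ l * q + k) = eps q * eps k"
  using assms
proof (induction l arbitrary: k)
  case (Suc l)
  have *: "eps (2 ^ l * q + k div 2) = eps q * eps (k div 2)" using Suc by auto
  show ?case
  proof (cases "even k")
    case True
    then obtain h where "k = 2 * h" by blast
    then have "2 ^ Suc l * q + k = 2 * (2 ^ l * q + h)" by simp
    with * show ?thesis using \<open>k = 2 * h\<close> by (simp only: eps_double) simp
  next
    case False
    then obtain h where "k = 2 * h + 1" by (auto elim: oddE)
    then have "2 ^ Suc l * q + k = 2 * (2 ^ l * q + h) + 1" by simp
    with * show ?thesis using \<open>k = 2 * h + 1\<close> by (simp only: eps_double_plus_1) simp
  qed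
qed simp

lemma eps_odd: "even m \<Longrightarrow> eps (Suc m) = - eps m"
  using eps_double eps_double_plus_1 by (auto elim!: evenE)

lemma eps_cases: "eps n = 1 \<or> eps n = -1"
  by (simp add: eps_def minus_one_power_iff)

lemma f_Suc: "f_5_0 (Suc n) = f_5_0 n + eps (5 * n)"
  by (simp add: f_5_0_def eps_def)

lemma eps_block: "eps (5 * (16 * n + i)) = eps (5 * n + 5 * i div 16) * eps (5 * i mod 16)"
proof -
  have "5 * (16 * n + i) = 2 ^ 4 * (5 * n + 5 * i div 16) + 5 * i mod 16" by simp
  then show ?thesis by (simp only:) (rule eps_append, simp)
qed

text \<open>For i < 16 the product 5 i carries at most 4 into 5 n, so only the signs of five
  consecutive integers occur; the fixed factor is the sign of 5 i mod 16.\<close>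

lemma block_steps:
  "map (\<lambda>i. eps (5 * (16 * n + i))) [0..<16] =
    [eps (5 * n), eps (5 * n), eps (5 * n), eps (5 * n),
     - eps (5 * n + 1), eps (5 * n + 1), - eps (5 * n + 1),
     eps (5 * n + 2), - eps (5 * n + 2), - eps (5 * n + 2),
     - eps (5 * n + 3), - eps (5 * n + 3), eps (5 * n + 3),
     - eps (5 * n + 4), eps (5 * n + 4), - eps (5 * n + 4)]"
  unfolding eps_block by (simp add: upt_rec[of _ 16] upt_rec[of _ "Suc _"] del: upt_Suc)

lemma f_block: "f_5_0 (m + r) = f_5_0 m + sum_list (map (\<lambda>i. eps (5 * (m + i))) [0..<r])"
  by (induction r) (simp_all add: f_Suc)

text \<open>Let \<open>e_i = eps (5 * n + i)\<close>. The signs at an even number and its successor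
  cancel, so a full block adds \<open>5 e_0 + e_5\<close> for even \<open>n\<close> and
  \<open>4 e_0\<close> for odd \<open>n\<close>, where the old correction supplies the fifth
  \<open>e_0\<close>.\<close>

lemma f_16: "f_5_0 (16 * n) = 5 * f_5_0 n + (if odd n then eps (5 * n) else 0)"
proof (induction n)
  case 0 show ?case by (simp add: f_5_0_def)
next
  case (Suc n)
  have odd_eps: "eps k = - eps m" if "even m" "k = m + 1" for k m
    using that eps_odd by simp
  have "f_5_0 (16 * Suc n) = f_5_0 (16 * n + 16)" by (simp add: algebra_simps)
  also have "\<dots> = f_5_0 (16 * n) + 4 * eps (5 * n) - eps (5 * n + 1) - eps (5 * n + 2)
      - eps (5 * n + 3) - eps (5 * n + 4)"
    unfolding f_block[of "16 * n" 16] block_steps by simp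
  finally have step: "f_5_0 (16 * Suc n) = f_5_0 (16 * n) + 4 * eps (5 * n) - eps (5 * n + 1)
      - eps (5 * n + 2) - eps (5 * n + 3) - eps (5 * n + 4)" .
  have next5: "5 * Suc n = 5 * n + 5" by simp
  show ?case
  proof (cases "even n")
    case True
    then have "eps (5 * n + 1) = - eps (5 * n)" "eps (5 * n + 3) = - eps (5 * n + 2)"
      "eps (5 * n + 5) = - eps (5 * n + 4)"
      by (intro odd_eps; simp)+
    with True show ?thesis unfolding step Suc next5 f_Suc by simp
  next
    case False
    then have "eps (5 * n + 2) = - eps (5 * n + 1)" "eps (5 * n + 4) = - eps (5 * n + 3)"
      by (intro odd_eps; simp)+
    with False show ?thesis unfolding step Suc next5 f_Suc by simp
  qed
qed

text \<open>
  Here \<open>d\<close> is the offset \<open>f(16 n + r) - 5 f(n)\<close>, \<open>b\<close> says that \<open>n\<close> is odd and \<open>s\<close> that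
  \<open>f(n + 1) = f(n) + 1\<close>. In \<open>offsets_ok\<close> the list holds the remaining increments of the block.
\<close>

definition offset_ok :: "bool \<Rightarrow> bool \<Rightarrow> int \<Rightarrow> int \<Rightarrow> bool" where
  "offset_ok b s r d \<longleftrightarrow>
    (if s then 0 \<le> d \<and> d \<le> 7 \<and>
        (5 \<le> d \<and> r \<le> 5 \<longrightarrow> r = 5 \<and> d = 5 \<or> 4 \<le> r \<and> b \<and> d \<le> r + 1)
     else -7 \<le> d \<and> d \<le> 0 \<and> (d = -7 \<longrightarrow> r \<le> 12))"

fun offsets_ok :: "bool \<Rightarrow> bool \<Rightarrow> int \<Rightarrow> int \<Rightarrow> int list \<Rightarrow> bool" where
  "offsets_ok b s r d [] \<longleftrightarrow> offset_ok b s r d"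
| "offsets_ok b s r d (x # xs) \<longleftrightarrow>
    offset_ok b s r d \<and> \<not> (d = 1 \<and> x = -1) \<and> offsets_ok b s (r + 1) (d + x) xs"

lemma offsets_okD:
  assumes "offsets_ok b s r d xs" and "k \<le> length xs"
  shows "offset_ok b s (r + int k) (d + sum_list (take k xs))"
    and "k < length xs \<Longrightarrow> xs ! k = -1 \<Longrightarrow> d + sum_list (take k xs) \<noteq> 1"
  using assms
proof (induction xs arbitrary: r d k)
  case (Cons x xs)
  {
    case 1
    then show ?case using Cons.IH(1)[of "r + 1" "d + x" "k - 1"]
      by (cases k) (auto simp: add_ac)
  next
    case 2
    then show ?case using Cons.IH(2)[of "k - 1" "r + 1" "d + x"]
      by (cases k) (auto simp: add_ac)
  }
qed auto

text \<open>Five consecutive integers meet at most two blocks of length 8. Hence everything depends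
  on \<open>j\<close>, which also gives the parity of \<open>n\<close>, and on the signs of
  \<open>q\<close> and \<open>Suc q\<close>: 32 cases, each evaluated.\<close>

lemma offsets_ok_block:
  "offsets_ok (odd n) (eps (5 * n) = 1) 0 (if odd n then eps (5 * n) else 0)
     (map (\<lambda>i. eps (5 * (16 * n + i))) [0..<16])"
proof -
  define q where "q = 5 * n div 8"
  define j where "j = 5 * n mod 8"
  have j: "j < 8" "5 * n = 8 * q + j" unfolding q_def j_def by simp_all
  have b: "odd n \<longleftrightarrow> odd j" unfolding j_def by presburger
  have window: "eps (5 * n + i) =
      (if j + i < 8 then eps q * eps (j + i) else eps (Suc q) * eps (j + i - 8))"
    if "i \<le> 4" for i
  proof (cases "j + i < 8")
    case True
    then show ?thesis using eps_append[of "j + i" 3 q] j by (simp add: add.assoc)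
  next
    case False
    then have "5 * n + i = 2 ^ 3 * Suc q + (j + i - 8)" using j by simp
    moreover have "j + i - 8 < 2 ^ 3" using j that by simp
    ultimately show ?thesis using False eps_append by presburger
  qed
  have window0: "eps (5 * n) = eps q * eps j" using window[of 0] j by simp
  have "eps 2 = -1" "eps 3 = 1" "eps 4 = -1" by simp_all
  then have eps_small: "eps (Suc (Suc 0)) = -1" "eps (Suc (Suc (Suc 0))) = 1"
    "eps (Suc (Suc (Suc (Suc 0)))) = -1"
    by (simp_all add: eval_nat_numeral del: eps_numeral)
  have le: "(1::nat) \<le> 4" "(2::nat) \<le> 4" "(3::nat) \<le> 4" "(4::nat) \<le> 4" by simp_all
  have "j \<in> {0,1,2,3,4,5,6,7}" using j by auto
  then show ?thesis
    unfolding block_steps b window0 le[THEN window]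
    using eps_cases[of q] eps_cases[of "Suc q"]
    by (elim insertE emptyE disjE; simp add: eps_small del: offsets_ok.simps; simp add: offset_ok_def)
qed

lemma take_map_upt: "k \<le> m \<Longrightarrow> take k (map g [0..<m]) = map g [0..<k]"
  by (simp add: take_map)

lemma f_offset_ok:
  assumes "r \<le> 16"
  shows "offset_ok (odd n) (eps (5 * n) = 1) (int r) (f_5_0 (16 * n + r) - 5 * f_5_0 n)"
  using offsets_okD(1)[OF offsets_ok_block, of r n] assms
  by (simp add: take_map_upt f_block[of "16 * n"] f_16 del: upt_Suc)

text \<open>A decrement thus never lands on offset 0. This spares \<open>f_lower\<close> a borrow
  from \<open>f_5_0 q\<close> itself, about which its induction hypothesis speaks only if
  \<open>q\<close> is reached by a decrement.\<close>

lemma f_descent: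
  assumes "r < 16" and "eps (5 * (16 * n + r)) = -1"
  shows "f_5_0 (16 * n + r) - 5 * f_5_0 n \<noteq> 1"
  using offsets_okD(2)[OF offsets_ok_block, of r n] assms
  by (simp add: take_map_upt f_block[of "16 * n"] f_16 del: upt_Suc)

lemma f_0 [simp]: "f_5_0 0 = 0"
  by (simp add: f_5_0_def)

lemma f_numeral [simp]:
  "f_5_0 (numeral k) = f_5_0 (pred_numeral k) + eps (5 * pred_numeral k)"
  "f_5_0 (Suc 0) = 1"
  using f_Suc[of 0] by (simp_all add: numeral_eq_Suc f_Suc)

text \<open>The hypothesis covers \<open>Suc n\<close> as well as \<open>n\<close>, because n + 1 <
  16 n for positive \<open>n\<close>.\<close>

lemma block_induct [case_names small block]:
  assumes "\<And>n. n < 16 \<Longrightarrow> Q n"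
    and "\<And>n r. n > 0 \<Longrightarrow> r < 16 \<Longrightarrow> (\<And>m. m < 16 * n + r \<Longrightarrow> Q m) \<Longrightarrow> Q (16 * n + r)"
  shows "Q (n :: nat)"
proof (induction n rule: less_induct)
  case (less n)
  show ?case
  proof (cases "n < 16")
    case False
    have "16 * (n div 16) + n mod 16 = n" by simp
    then show ?thesis using assms(2)[of "n div 16" "n mod 16"] less False by (simp add: div_greater_zero_iff)
  qed (rule assms(1))
qed

lemma less_16_cases:
  fixes n :: nat
  assumes "n < 16"
  shows "n \<in> {0,1,2,3,4,5,6,7,8,9,10,11,12,13,14,15}"
  using assms by (simp, presburger)

text \<open>A negative offset requires \<open>f_5_0 (Suc n) = f_5_0 n - 1\<close>; then
  \<open>f_5_0 n\<close> is at least 2, and 10 - 7 is still positive.\<close>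

lemma f_pos: "n > 0 \<Longrightarrow> f_5_0 n > 0"
proof (induction n rule: block_induct)
  case (small n)
  with less_16_cases[OF small(1)] show ?case by (elim insertE emptyE) simp_all
next
  case (block n r)
  then have "f_5_0 n > 0" "f_5_0 (Suc n) > 0" by auto
  then show ?case using f_offset_ok[of r n] block.hyps eps_cases[of "5 * n"]
    by (auto simp: offset_ok_def f_Suc split: if_splits)
qed

subsection \<open>Rereading base 5 in base 16\<close>

text \<open>Integer arguments avoid truncated subtraction in borrows. Negative ones are read as 0,
  which keeps the map monotone.\<close>

definition p_int :: "int \<Rightarrow> int" where
  "p_int x = int (p_5_16 (nat x))"

lemma p_digit:
  assumes "d < 5"
  shows "p_5_16 (5 * q + d) = 16 * p_5_16 q + d"
proof (cases "5 * q + d = 0")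
  case True
  then show ?thesis by (simp add: p_5_16_def base_rep.simps[of 5 0] base_val_def)
next
  case False
  then have "base_rep 5 (5 * q + d) = base_rep 5 q @ [d]"
    using assms by (subst base_rep.simps) auto
  then show ?thesis by (simp add: p_5_16_def base_val_snoc)
qed

lemma p_int_digit:
  assumes "0 \<le> x" "0 \<le> d" "d < 5"
  shows "p_int (5 * x + d) = 16 * p_int x + d"
  using assms p_digit[of "nat d" "nat x"] by (simp add: p_int_def nat_add_distrib nat_mult_distrib)

lemma p_less_Suc: "p_5_16 m < p_5_16 (Suc m)"
proof (induction m rule: less_induct)
  case (less m)
  define q d where "q = m div 5" and "d = m mod 5"
  have m: "m = 5 * q + d" "d < 5" by (simp_all add: q_def d_def)
  show ?case
  proof (cases "d < 4")
    case True
    then show ?thesis using m p_digit[of d q] p_digit[of "Suc d" q] by simp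
  next
    case False
    then have "m = 5 * q + 4" "Suc m = 5 * Suc q + 0" using m by simp_all
    moreover have "p_5_16 q < p_5_16 (Suc q)" using less m False by simp
    ultimately show ?thesis using p_digit[of 4 q] p_digit[of 0 "Suc q"] by simp
  qed
qed

lemma p_int_mono: "x \<le> y \<Longrightarrow> p_int x \<le> p_int y"
  using lift_Suc_mono_le[of p_5_16 "nat x" "nat y"] p_less_Suc by (simp add: p_int_def less_imp_le nat_mono)

lemma p_int_pred:
  assumes "x > 0" and "\<not> 5 dvd x"
  shows "p_int (x - 1) = p_int x - 1"
proof -
  define q d where "q = x div 5" and "d = x mod 5"
  have x: "x = 5 * q + d" "0 \<le> d" "d < 5" "q \<ge> 0" using assms by (simp_all add: q_def d_def)
  moreover have "d \<noteq> 0" using assms by (auto simp: d_def)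
  ultimately show ?thesis using p_int_digit[of q d] p_int_digit[of q "d - 1"] by (simp add: add_diff_eq)
qed

lemma p_int_small: "0 \<le> x \<Longrightarrow> x < 5 \<Longrightarrow> p_int x = x" "p_int 5 = 16" "p_int 6 = 17"
proof -
  have p_int_0: "p_int 0 = 0" by (simp add: p_int_def p_5_16_def base_rep.simps[of 5 0] base_val_def)
  show *: "0 \<le> x \<Longrightarrow> x < 5 \<Longrightarrow> p_int x = x" for x using p_int_digit[of 0 x] p_int_0 by simp
  show "p_int 5 = 16" "p_int 6 = 17" using p_int_digit[of 1 0] p_int_digit[of 1 1] *[of 1] by simp_all
qed

subsection \<open>The linear bounds\<close>

text \<open>The extremal arguments are successors of these numbers: only the last digit changes,
  which gives 1, 5, 45, 445 and so on for digit 4.\<close>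

fun repdigit :: "nat \<Rightarrow> nat \<Rightarrow> nat" where
  "repdigit d 0 = 0"
| "repdigit d (Suc k) = 16 * repdigit d k + d"

text \<open>An offset of at least 5 carries into \<open>f_5_0 (Suc n)\<close>. Sixteen times the
  bound there has constant 64, which is \<open>15 * r - 11\<close> at \<open>r = 5\<close>; so
  offset 5 at \<open>r = 5\<close> is the only tight case.\<close>

lemma f_upper:
  assumes "n > 0"
  shows "4 * p_int (f_5_0 n) \<le> 15 * int n - 11 \<and>
    (4 * p_int (f_5_0 n) = 15 * int n - 11 \<longrightarrow> (\<exists>k. n = Suc (repdigit 4 k)))"
  using assms
proof (induction n rule: block_induct)
  case (small n)
  have "5 = Suc (repdigit 4 1)" "1 = Suc (repdigit 4 0)" by simp_all
  then have "\<exists>k. 5 = Suc (repdigit 4 k)" "\<exists>k. 1 = Suc (repdigit 4 k)" by blast+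
  with small less_16_cases[OF small(1)] show ?case
    by (elim insertE emptyE) (simp_all add: p_int_small)
next
  case (block n r)
  define d where "d = f_5_0 (16 * n + r) - 5 * f_5_0 n"
  have d: "offset_ok (odd n) (eps (5 * n) = 1) (int r) d"
    using f_offset_ok[of r n] block by (simp add: d_def)
  have fN: "f_5_0 (16 * n + r) = 5 * f_5_0 n + d" by (simp add: d_def)
  have pos: "f_5_0 n > 0" using f_pos block by simp
  have IH: "4 * p_int (f_5_0 n) \<le> 15 * int n - 11" using block by simp
  have IH': "4 * p_int (f_5_0 (Suc n)) \<le> 15 * int n + 4"
    "4 * p_int (f_5_0 (Suc n)) = 15 * int n + 4 \<Longrightarrow> \<exists>k. Suc n = Suc (repdigit 4 k)"
    using block.IH[of "Suc n"] block.hyps by (auto simp: algebra_simps)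
  consider "eps (5 * n) = -1" | "eps (5 * n) = 1" "d \<le> 4" | "eps (5 * n) = 1" "5 \<le> d"
    using eps_cases[of "5 * n"] by linarith
  then show ?case
  proof cases
    case 1
    have "p_int (5 * f_5_0 n + d) \<le> p_int (5 * f_5_0 n + 0)" using 1 d by (intro p_int_mono) (simp add: offset_ok_def)
    also have "\<dots> = 16 * p_int (f_5_0 n)" using p_int_digit[of "f_5_0 n" 0] pos by simp
    finally show ?thesis using IH fN by simp
  next
    case 2
    then have "p_int (5 * f_5_0 n + d) = 16 * p_int (f_5_0 n) + d" using p_int_digit d pos by (simp add: offset_ok_def)
    then show ?thesis using IH fN 2 by simp
  next
    case 3
    then have fN': "f_5_0 (16 * n + r) = 5 * f_5_0 (Suc n) + (d - 5)" using fN by (simp add: f_Suc)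
    have p_int: "p_int (f_5_0 (16 * n + r)) = 16 * p_int (f_5_0 (Suc n)) + (d - 5)"
      unfolding fN' using p_int_digit[of "f_5_0 (Suc n)" "d - 5"] d 3 pos by (simp add: offset_ok_def f_Suc)
    have dr: "d \<le> 7" "r \<le> 5 \<Longrightarrow> r = 5 \<and> d = 5 \<or> 4 \<le> r \<and> odd n \<and> d \<le> int r + 1"
      using d 3 by (auto simp: offset_ok_def)
    \<comment> \<open>Equality would make \<open>n\<close> a multiple of 4. For odd \<open>n\<close>
      the bound improves by 1, hence by 16 after scaling, which is enough for
      \<open>r = 4\<close>.\<close>
    have odd: "4 * p_int (f_5_0 (Suc n)) \<noteq> 15 * int n + 4" if "odd n"
      using that by presburger
    consider "r \<ge> 6" | "r = 5" "d = 5" | "4 \<le> r" "r \<le> 5" "odd n" "d \<le> int r + 1"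
      using dr(2) by linarith
    then show ?thesis
    proof cases
      case 1
      then show ?thesis using p_int IH'(1) dr(1) by simp
    next
      case 2
      have "\<exists>k. 16 * n + r = Suc (repdigit 4 k)" if eq: "4 * p_int (f_5_0 (Suc n)) = 15 * int n + 4"
      proof -
        obtain k where "n = repdigit 4 k" using IH'(2)[OF eq] by auto
        then have "16 * n + r = Suc (repdigit 4 (Suc k))" using 2 by simp
        then show ?thesis by blast
      qed
      then show ?thesis using p_int IH'(1) 2 by auto
    next
      case 3
      then show ?thesis using p_int IH'(1) odd by auto
    qed
  qed
qed

text \<open>
  The second conjunct serves a borrow: if \<open>f(16 n + r) = 5 f(n + 1) - 1\<close> or \<open>5 f(n + 1) - 2\<close>, its
  leading part is \<open>f(n + 1) - 1\<close>. The constant 36 is \<open>176 - 140\<close>, as \<open>p(x - 1) = p(x) - 1\<close> unless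
  5 divides \<open>x\<close>; in that case one descends a block further.
\<close>

lemma f_lower:
  "(n > 1 \<longrightarrow> 176 * p_int (f_5_0 n) \<ge> 47 * int n + 140 \<and>
     (176 * p_int (f_5_0 n) = 47 * int n + 140 \<longrightarrow> (\<exists>k. n = Suc (repdigit 11 (Suc k))))) \<and>
   (\<forall>m. n = Suc m \<and> eps (5 * m) = -1 \<longrightarrow> 176 * p_int (f_5_0 n - 1) \<ge> 47 * int n - 36 \<and>
     (176 * p_int (f_5_0 n - 1) = 47 * int n - 36 \<longrightarrow> (\<exists>k. n = Suc (repdigit 11 (Suc k)))))"
  (is "?A n \<and> ?B n")
proof (induction n rule: block_induct)
  case (small n)
  have "12 = Suc (repdigit 11 (Suc 0))" by simp
  then have "\<exists>k. 12 = Suc (repdigit 11 (Suc k))" by blast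
  with small less_16_cases[OF small(1)] show ?case
    by (elim insertE emptyE) (auto simp: p_int_small)
next
  case (block n r)
  define d where "d = f_5_0 (16 * n + r) - 5 * f_5_0 n"
  have d: "offset_ok (odd n) (eps (5 * n) = 1) (int r) d"
    using f_offset_ok[of r n] block by (simp add: d_def)
  have fN: "f_5_0 (16 * n + r) = 5 * f_5_0 n + d" by (simp add: d_def)
  have pos: "f_5_0 n > 0" "f_5_0 (Suc n) > 0" using f_pos block by simp_all
  \<comment> \<open>The constant 129 = 176 - 47 is exact at \<open>m = 1\<close>, where the bound
    with 140 fails.\<close>
  have weak: "176 * p_int (f_5_0 m) \<ge> 47 * int m + 129" if "m > 0" "m < 16 * n + r" for m
  proof (cases "m = 1")
    case False then show ?thesis using block.IH[of m] that by auto
  qed (simp add: p_int_small)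
  have A: "?A (16 * n + r)"
  proof -
    consider "d \<ge> 0" | "eps (5 * n) = -1" "-5 \<le> d" "d < 0" | "eps (5 * n) = -1" "d < -5"
      using d eps_cases[of "5 * n"] by (fastforce simp: offset_ok_def)
    then show ?thesis
    proof cases
      case 1
      have "16 * p_int (f_5_0 n) \<le> p_int (f_5_0 (16 * n + r))"
        using p_int_mono[of "5 * f_5_0 n + 0" "f_5_0 (16 * n + r)"] p_int_digit[of "f_5_0 n" 0] 1 pos fN by simp
      moreover have "176 * p_int (f_5_0 n) \<ge> 47 * int n + 129" using weak[of n] block.hyps by simp
      ultimately show ?thesis using block.hyps by auto
    next
      case 2
      then have "16 * p_int (f_5_0 (Suc n)) \<le> p_int (f_5_0 (16 * n + r))"
        using p_int_mono[of "5 * f_5_0 (Suc n) + 0" "f_5_0 (16 * n + r)"] p_int_digit[of "f_5_0 (Suc n)" 0]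
          pos fN by (simp add: f_Suc)
      moreover have "176 * p_int (f_5_0 (Suc n)) \<ge> 47 * int (Suc n) + 129"
        using weak[of "Suc n"] block.hyps by simp
      ultimately show ?thesis using block.hyps by auto
    next
      case 3
      then have d67: "d = -6 \<or> d = -7 \<and> r \<le> 12" using d by (auto simp: offset_ok_def)
      have B: "?B (Suc n)" using block.IH[of "Suc n"] block.hyps by simp
      have "f_5_0 (16 * n + r) = 5 * (f_5_0 (Suc n) - 1) + (d + 10)" using 3 fN by (simp add: f_Suc)
      then have p_int: "p_int (f_5_0 (16 * n + r)) = 16 * p_int (f_5_0 (Suc n) - 1) + (d + 10)"
        using p_int_digit[of "f_5_0 (Suc n) - 1" "d + 10"] pos d67 by auto
      have IH: "176 * p_int (f_5_0 (Suc n) - 1) \<ge> 47 * int n + 11"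
        "176 * p_int (f_5_0 (Suc n) - 1) = 47 * int n + 11 \<Longrightarrow> \<exists>k. n = repdigit 11 (Suc k)"
        using B 3 by auto
      have "\<exists>k. 16 * n + r = Suc (repdigit 11 (Suc k))"
        if eq: "176 * p_int (f_5_0 (16 * n + r)) = 47 * int (16 * n + r) + 140"
      proof -
        \<comment> \<open>Since 16 * 11 + 176 * 3 = 704 = 47 * 12 + 140, equality needs offset -7
          and the largest \<open>r\<close> allowed with it.\<close>
        have "r = 12" "176 * p_int (f_5_0 (Suc n) - 1) = 47 * int n + 11"
          using eq p_int IH(1) d67 block.hyps by auto
        then obtain k where "n = repdigit 11 (Suc k)" using IH(2) by auto
        then have "16 * n + r = Suc (repdigit 11 (Suc (Suc k)))" using \<open>r = 12\<close> by simp
        then show ?thesis by blast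
      qed
      then show ?thesis using p_int IH(1) d67 block.hyps by auto
    qed
  qed
  have "?B (16 * n + r)"
  proof (intro allI impI)
    fix m assume m: "16 * n + r = Suc m \<and> eps (5 * m) = -1"
    \<comment> \<open>The block is that of the predecessor \<open>m\<close>, so that the last
      decrement lies inside it; \<open>Suc s\<close> may be 16.\<close>
    define q s where "q = m div 16" and "s = m mod 16"
    have qs: "m = 16 * q + s" "s < 16" by (simp_all add: q_def s_def)
    \<comment> \<open>As \<open>n > 0\<close>, only \<open>m = 15\<close> could give
      \<open>q = 0\<close>, but the sign of 75 is +1.\<close>
    have "q > 0"
    proof (rule ccontr)
      assume "\<not> q > 0"
      then have "m = 15" using m qs block.hyps by simp
      then show False using m by simp
    qed
    have N: "16 * n + r = 16 * q + Suc s" using m qs by simp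
    define c where "c = f_5_0 (16 * q + Suc s) - 5 * f_5_0 q"
    have fq: "f_5_0 (16 * q + Suc s) = 5 * f_5_0 q + c" by (simp add: c_def)
    have c: "offset_ok (odd q) (eps (5 * q) = 1) (int (Suc s)) c"
      using f_offset_ok[of "Suc s" q] qs by (simp add: c_def)
    have "c \<noteq> 0" using f_descent[of s q] m qs by (auto simp: c_def f_Suc)
    have fpos: "f_5_0 (16 * q + Suc s) > 0" "f_5_0 q > 0" "f_5_0 (Suc q) > 0"
      using f_pos \<open>q > 0\<close> by simp_all
    \<comment> \<open>If 5 divides the value, it divides the nonzero offset \<open>c\<close>, which
      is then 5 or -5. For -5 the second conjunct applies at \<open>Suc q\<close>, itself reached by
      a decrement.\<close>
    consider "\<not> 5 dvd f_5_0 (16 * q + Suc s)" | "c = 5" | "eps (5 * q) = -1" "c = -5"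
    proof (cases "5 dvd c")
      case True
      then obtain k where "c = 5 * k" by blast
      then show ?thesis using that(2,3) \<open>c \<noteq> 0\<close> c eps_cases[of "5 * q"]
        by (auto simp: offset_ok_def split: if_splits)
    next
      case False
      then have "\<not> 5 dvd f_5_0 (16 * q + Suc s)" unfolding fq by presburger
      then show ?thesis by (rule that(1))
    qed
    then show "47 * int (16 * n + r) - 36 \<le> 176 * p_int (f_5_0 (16 * n + r) - 1) \<and>
      (176 * p_int (f_5_0 (16 * n + r) - 1) = 47 * int (16 * n + r) - 36 \<longrightarrow>
        (\<exists>k. 16 * n + r = Suc (repdigit 11 (Suc k))))"
    proof cases
      case 1
      then have "p_int (f_5_0 (16 * n + r) - 1) = p_int (f_5_0 (16 * n + r)) - 1"
        unfolding N using p_int_pred fpos by blast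
      then show ?thesis using A block.hyps by auto
    next
      case 2
      then have *: "f_5_0 (16 * n + r) - 1 = 5 * f_5_0 q + 4" unfolding N fq by simp
      have "p_int (f_5_0 (16 * n + r) - 1) = 16 * p_int (f_5_0 q) + 4"
        unfolding * using p_int_digit[of "f_5_0 q" 4] fpos by simp
      moreover have "176 * p_int (f_5_0 q) \<ge> 47 * int q + 129"
        using weak[of q] \<open>q > 0\<close> N by simp
      ultimately show ?thesis unfolding N using qs by auto
    next
      case 3
      then have "f_5_0 (16 * n + r) - 1 = 5 * (f_5_0 (Suc q) - 1) + 4"
        unfolding N fq by (simp add: f_Suc)
      then have "p_int (f_5_0 (16 * n + r) - 1) = 16 * p_int (f_5_0 (Suc q) - 1) + 4"
        using p_int_digit[of "f_5_0 (Suc q) - 1" 4] fpos by simp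
      moreover have "176 * p_int (f_5_0 (Suc q) - 1) \<ge> 47 * int (Suc q) - 36"
        using block.IH[of "Suc q"] N \<open>q > 0\<close> 3 by simp
      ultimately show ?thesis unfolding N using qs by auto
    qed
  qed
  with A show ?case by blast
qed

section \<open>Sharpness of the linear bounds\<close>

lemma f_block_take: "r \<le> 16 \<Longrightarrow> f_5_0 (16 * n + r) =
    f_5_0 (16 * n) + sum_list (take r (map (\<lambda>i. eps (5 * (16 * n + i))) [0..<16]))"
  by (simp add: take_map_upt f_block del: upt_Suc)

text \<open>The sign and the evenness of \<open>n\<close> force offset 5 at \<open>r = 5\<close>.
  The sign persists since 5 (16 n + 4) = 16 (5 n + 1) + 4.\<close>

lemma f_upper_attained:
  "4 * p_int (f_5_0 (Suc (repdigit 4 k))) = 15 * int (Suc (repdigit 4 k)) - 11 \<and>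
    eps (5 * repdigit 4 k) = 1"
proof (induction k)
  case 0 show ?case by (simp add: p_int_small)
next
  case (Suc k)
  define n where "n = repdigit 4 k"
  have n: "even n" unfolding n_def by (cases k) simp_all
  have IH: "4 * p_int (f_5_0 (Suc n)) = 15 * int n + 4" "eps (5 * n) = 1" using Suc by (simp_all add: n_def)
  have e1: "eps (5 * n + 1) = -1" using eps_odd[of "5 * n"] n IH by simp
  have "f_5_0 (16 * n + 5) = 5 * f_5_0 (Suc n) + 0"
    using f_block_take[of 5 n] e1 IH n unfolding block_steps by (simp add: f_16 f_Suc)
  then have p_int: "p_int (f_5_0 (16 * n + 5)) = 16 * p_int (f_5_0 (Suc n))"
    using p_int_digit[of "f_5_0 (Suc n)" 0] f_pos[of "Suc n"] by simp
  have e: "eps (5 * (16 * n + 4)) = 1" unfolding eps_block using e1 by simp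
  have rep: "repdigit 4 (Suc k) = 16 * n + 4" "Suc (16 * n + 4) = 16 * n + 5"
    by (simp_all add: n_def)
  show ?case unfolding rep p_int e using IH by simp
qed

text \<open>With \<open>n\<close> odd, the two signs force offset -7 at \<open>r = 12\<close>;
  nondivisibility lets the leading part \<open>f_5_0 (Suc n)\<close> drop by 1 without a further
  borrow.\<close>

lemma f_lower_attained:
  "176 * p_int (f_5_0 (Suc (repdigit 11 (Suc k)))) = 47 * int (Suc (repdigit 11 (Suc k))) + 140 \<and>
    eps (5 * repdigit 11 (Suc k)) = -1 \<and> eps (5 * repdigit 11 (Suc k) + 3) = 1 \<and>
    \<not> 5 dvd f_5_0 (Suc (repdigit 11 (Suc k)))"
proof (induction k)
  case 0 show ?case by (simp add: p_int_small)
next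
  case (Suc k)
  define n where "n = repdigit 11 (Suc k)"
  have n: "odd n" unfolding n_def by simp
  have IH: "176 * p_int (f_5_0 (Suc n)) = 47 * int n + 187" "eps (5 * n) = -1" "eps (5 * n + 3) = 1"
    "\<not> 5 dvd f_5_0 (Suc n)" using Suc by (simp_all add: n_def)
  have e2: "eps (5 * n + 2) = - eps (5 * n + 1)" using eps_odd[of "5 * n + 1"] n by simp
  have f: "f_5_0 (16 * n + 12) = 5 * (f_5_0 (Suc n) - 1) + 3"
    using f_block_take[of 12 n] e2 IH n unfolding block_steps by (simp add: f_16 f_Suc)
  have p_int: "p_int (f_5_0 (16 * n + 12)) = 16 * p_int (f_5_0 (Suc n)) - 13"
    unfolding f using p_int_digit[of "f_5_0 (Suc n) - 1" 3] p_int_pred[of "f_5_0 (Suc n)"] f_pos[of "Suc n"] IH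
    by simp
  have ndvd: "\<not> 5 dvd f_5_0 (16 * n + 12)" unfolding f by presburger
  have e: "eps (5 * (16 * n + 11)) = -1" unfolding eps_block using IH by simp
  have "5 * (16 * n + 11) + 3 = 2 ^ 4 * (5 * n + 3) + 10" by simp
  then have e3: "eps (5 * (16 * n + 11) + 3) = 1" using eps_append[of 10 4 "5 * n + 3"] IH by simp
  have rep: "repdigit 11 (Suc (Suc k)) = 16 * n + 11" "Suc (16 * n + 11) = 16 * n + 12"
    by (simp_all add: n_def)
  show ?case unfolding rep p_int e e3 using IH ndvd by simp
qed

subsection \<open>The languages of extremal arguments\<close>

lemma base_rep_snoc:
  assumes "1 < c" "d < c" "0 < n \<or> 0 < d"
  shows "base_rep c (c * n + d) = base_rep c n @ [d]"
  using assms by (subst base_rep.simps) auto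

lemma base_rep_repdigit: "0 < d \<Longrightarrow> d < 16 \<Longrightarrow> base_rep 16 (repdigit d k) = replicate k d"
proof (induction k)
  case (Suc k)
  then show ?case using base_rep_snoc[of 16 d "repdigit d k"] by (simp add: replicate_append_same)
qed (simp add: base_rep.simps[of 16 0])

lemma base_rep_Suc_repdigit:
  assumes "0 < d" "Suc d < 16"
  shows "base_rep 16 (Suc (repdigit d (Suc k))) = replicate k d @ [Suc d]"
  using base_rep_snoc[of 16 "Suc d" "repdigit d k"] base_rep_repdigit[of d k] assms by simp

lemma base_rep_inject: "2 \<le> c \<Longrightarrow> base_rep c m = base_rep c n \<longleftrightarrow> m = n"
  using base_val_base_rep by metis

lemma star_singleton: "star {[a]} = range (\<lambda>k. replicate k a)"
proof -
  have "concat ws \<in> range (\<lambda>k. replicate k a)" if "set ws \<subseteq> {[a]}" for ws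
  proof
    show "concat ws = replicate (length ws) a" using that by (induction ws) auto
  qed simp
  moreover have "replicate k a \<in> star {[a]}" for k
  proof -
    have "replicate k a = concat (replicate k [a])" by (induction k) simp_all
    moreover have "set (replicate k [a]) \<subseteq> {[a]}" by auto
    ultimately show ?thesis unfolding star_def by blast
  qed
  ultimately show ?thesis by (auto simp: star_def)
qed

lemma lower_language:
  "base_rep 16 n \<in> star {[11]} \<cdot> {[12]} \<longleftrightarrow> (\<exists>k. n = Suc (repdigit 11 (Suc k)))"
proof -
  have "base_rep 16 n \<in> star {[11]} \<cdot> {[12]} \<longleftrightarrow> (\<exists>k. base_rep 16 n = replicate k 11 @ [12])"
    by (auto simp: conc_def star_singleton)
  also have "\<dots> \<longleftrightarrow> (\<exists>k. base_rep 16 n = base_rep 16 (Suc (repdigit 11 (Suc k))))"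
    using base_rep_Suc_repdigit[of 11] by simp
  finally show ?thesis by (simp only: base_rep_inject)
qed

text \<open>The word is \<open>[1]\<close> for \<open>k = 0\<close>, \<open>[5]\<close> for
  \<open>k = 1\<close>, and starts with 4 from \<open>k = 2\<close> on; hence the existential is
  split twice.\<close>

lemma upper_language:
  "base_rep 16 n \<in> {[1], [5]} \<union> {[4]} \<cdot> star {[4]} \<cdot> {[5]} \<longleftrightarrow> (\<exists>k. n = Suc (repdigit 4 k))"
proof -
  have nat_ex: "(\<exists>k. Q k) \<longleftrightarrow> Q 0 \<or> (\<exists>k. Q (Suc k))" for Q :: "nat \<Rightarrow> bool"
    by (metis not0_implies_Suc)
  have inject: "base_rep 16 n = base_rep 16 m \<longleftrightarrow> n = m" for m
    by (rule base_rep_inject) simp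
  have rep: "base_rep 16 (Suc (repdigit 4 0)) = [1]"
    "base_rep 16 (Suc (repdigit 4 (Suc k))) = replicate k 4 @ [5]" for k
    using base_rep_snoc[of 16 1 0] base_rep_Suc_repdigit[of 4 k] by (simp_all add: base_rep.simps[of 16 0])
  have "{[4]} \<cdot> star {[4]} \<cdot> {[5]} = range (\<lambda>k. replicate (Suc k) 4 @ [5 :: nat])"
    unfolding conc_def star_singleton by auto
  then have "base_rep 16 n \<in> {[1], [5]} \<union> {[4]} \<cdot> star {[4]} \<cdot> {[5]} \<longleftrightarrow>
      base_rep 16 n = [1] \<or> base_rep 16 n = replicate 0 4 @ [5] \<or>
      (\<exists>k. base_rep 16 n = replicate (Suc k) 4 @ [5])"
    by auto
  also have "\<dots> \<longleftrightarrow> (\<exists>k. n = Suc (repdigit 4 k))"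
    unfolding rep[symmetric] inject nat_ex[of "\<lambda>k. n = Suc (repdigit 4 k)"]
      nat_ex[of "\<lambda>k. n = Suc (repdigit 4 (Suc k))"] ..
  finally show ?thesis .
qed

subsection \<open>The power bounds\<close>

text \<open>Write each power as x times its power of exponent \<alpha> - 1, and enlarge the base of
  the second factor to a + b.\<close>

lemma powr_superadditive:
  fixes a b \<alpha> :: real
  assumes "1 \<le> \<alpha>" "0 \<le> a" "0 \<le> b"
  shows "a powr \<alpha> + b powr \<alpha> \<le> (a + b) powr \<alpha>"
proof -
  have split: "x powr \<alpha> = x * x powr (\<alpha> - 1)" if "0 \<le> x" for x
    using powr_mult_base[OF that, of "\<alpha> - 1"] by simp
  have "a * a powr (\<alpha> - 1) \<le> a * (a + b) powr (\<alpha> - 1)" "b * b powr (\<alpha> - 1) \<le> b * (a + b) powr (\<alpha> - 1)"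
    using assms by (auto intro!: mult_left_mono powr_mono2)
  then show ?thesis using assms by (simp add: split distrib_right)
qed

definition \<alpha> :: real where
  "\<alpha> = ln 16 / ln 5"

lemma \<alpha>_ge_1: "\<alpha> \<ge> 1"
  by (simp add: \<alpha>_def)

lemma five_powr_\<alpha>: "5 powr \<alpha> = 16"
  by (simp add: \<alpha>_def powr_def)

lemma five_power_powr_\<alpha>: "(5 ^ k) powr \<alpha> = 16 ^ k"
  by (induction k) (simp_all add: powr_mult five_powr_\<alpha>)

text \<open>Split off the last digit: multiplying by 5 scales the power by 16, and superadditivity
  absorbs the digit.\<close>

lemma p_le_powr: "real (p_5_16 m) \<le> real m powr \<alpha>"
proof (induction m rule: less_induct)
  case (less m)
  show ?case
  proof (cases "m = 0")
    case True
    then show ?thesis using p_digit[of 0 0] by simp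
  next
    case False
    define q d where "q = m div 5" and "d = m mod 5"
    have m: "m = 5 * q + d" "d < 5" "q < m" using False by (simp_all add: q_def d_def)
    have "real d \<le> real d powr \<alpha>"
    proof (cases "d = 0")
      case False
      then show ?thesis using powr_mono[OF \<alpha>_ge_1, of "real d"] by simp
    qed simp
    moreover have "16 * real (p_5_16 q) \<le> (5 * real q) powr \<alpha>"
      using less m by (simp add: powr_mult five_powr_\<alpha>)
    moreover have "(5 * real q) powr \<alpha> + real d powr \<alpha> \<le> (5 * real q + real d) powr \<alpha>"
      by (rule powr_superadditive) (use \<alpha>_ge_1 in simp_all)
    ultimately show ?thesis using p_digit[of d q] m by simp
  qed
qed

text \<open>In the interval from x to 5 the points 1 and x + 4 are mirror images, so convexity
  bounds the sum of their powers by that at the endpoints. This settles d = 4; other d interpolate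
  between 0 and 4.\<close>

lemma powr_shift:
  assumes "0 < x" "x \<le> 1" "0 \<le> d" "d \<le> 4"
  shows "(d + x) powr \<alpha> \<le> 15 / 4 * d + x powr \<alpha>"
proof -
  note convex = convex_onD[OF powr_convex[OF \<alpha>_ge_1], unfolded real_scaleR_def]
  define u where "u = (1 - x) / (5 - x)"
  have u: "0 \<le> u" "u \<le> 1" "u * (5 - x) = 1 - x" using assms by (simp_all add: u_def)
  have "1 powr \<alpha> \<le> (1 - u) * x powr \<alpha> + u * 5 powr \<alpha>"
    using convex[of u x 5] u assms by (simp add: algebra_simps)
  moreover have "(x + 4) powr \<alpha> \<le> u * x powr \<alpha> + (1 - u) * 5 powr \<alpha>"
  proof -
    have *: "(1 - (1 - u)) * x + (1 - u) * 5 = x + 4" using u(3) by (simp add: algebra_simps)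
    show ?thesis using convex[of "1 - u" x 5] u(1,2) assms unfolding * by simp
  qed
  ultimately have "(x + 4) powr \<alpha> \<le> x powr \<alpha> + 15"
    by (simp add: five_powr_\<alpha> algebra_simps)
  then have "d / 4 * (x + 4) powr \<alpha> \<le> d / 4 * (x powr \<alpha> + 15)"
    using assms by (intro mult_left_mono) simp_all
  moreover have "(d + x) powr \<alpha> \<le> (1 - d / 4) * x powr \<alpha> + d / 4 * (x + 4) powr \<alpha>"
  proof -
    have *: "(1 - d / 4) * x + d / 4 * (x + 4) = d + x" by (simp add: field_simps)
    show ?thesis using convex[of "d / 4" x "x + 4"] assms unfolding * by simp
  qed
  ultimately show ?thesis by (simp add: algebra_simps)
qed

lemma p_leading_digit:
  assumes "r < 5 ^ k" "d < 5"
  shows "p_5_16 (5 ^ k * d + r) = 16 ^ k * d + p_5_16 r"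
  using assms(1)
proof (induction k arbitrary: r)
  case 0
  then show ?case using p_digit[of d 0] p_digit[of 0 0] assms(2) by simp
next
  case (Suc k)
  define q c where "q = r div 5" and "c = r mod 5"
  have r: "r = 5 * q + c" "c < 5" by (simp_all add: q_def c_def)
  have q: "q < 5 ^ k" using Suc.prems r by simp
  have eq: "5 ^ Suc k * d + r = 5 * (5 ^ k * d + q) + c" using r by simp
  have "p_5_16 r = 16 * p_5_16 q + c" using p_digit[of c q] r by simp
  then show ?case unfolding eq p_digit[OF r(2)] Suc.IH[OF q] by simp
qed

text \<open>Equality holds at \<open>m = 5\<^sup>k - 1\<close>; the induction strips the leading digit.\<close>

lemma powr_le_p:
  assumes "m < 5 ^ k"
  shows "(real m + 1) powr \<alpha> \<le> 15 / 4 * real (p_5_16 m) + 1"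
  using assms
proof (induction k arbitrary: m)
  case 0
  then show ?case using p_digit[of 0 0] by simp
next
  case (Suc k)
  define d r where "d = m div 5 ^ k" and "r = m mod 5 ^ k"
  have m: "m = 5 ^ k * d + r" "r < 5 ^ k" "d < 5" using Suc.prems
    by (simp_all add: d_def r_def less_mult_imp_div_less)
  \<comment> \<open>Scaling by \<open>5 ^ k\<close> brings \<open>r + 1\<close> into the range of
    \<open>powr_shift\<close>; scaling back gives the induction hypothesis for
    \<open>r\<close>.\<close>
  define x where "x = (real r + 1) / 5 ^ k"
  have "real r + 1 \<le> 5 ^ k" using m(2) by (metis Suc_leI of_nat_Suc of_nat_le_iff of_nat_numeral of_nat_power add.commute)
  then have x: "0 < x" "x \<le> 1" "real r + 1 = 5 ^ k * x" by (simp_all add: x_def)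
  have "real m + 1 = 5 ^ k * (real d + x)" using m(1) x(3) by (simp add: distrib_left)
  then have "(real m + 1) powr \<alpha> = (5 ^ k * (real d + x)) powr \<alpha>" by simp
  also have "\<dots> = 16 ^ k * (real d + x) powr \<alpha>"
    using x by (simp add: powr_mult five_power_powr_\<alpha>)
  also have "\<dots> \<le> 16 ^ k * (15 / 4 * real d + x powr \<alpha>)"
    using powr_shift[of x "real d"] x m(3) by (intro mult_left_mono) simp_all
  also have "\<dots> = 15 / 4 * (16 ^ k * real d) + (5 ^ k * x) powr \<alpha>"
    using x by (simp add: powr_mult five_power_powr_\<alpha> algebra_simps)
  also have "\<dots> \<le> 15 / 4 * (16 ^ k * real d) + (15 / 4 * real (p_5_16 r) + 1)"
    using Suc.IH[OF m(2)] x(3) by simp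
  also have "\<dots> = 15 / 4 * real (p_5_16 m) + 1"
    using p_leading_digit[OF m(2,3)] m(1) by (simp add: algebra_simps)
  finally show ?case .
qed

text \<open>Superadditivity cancels the 1 on both sides of \<open>powr_le_p\<close>.\<close>

lemma powr_le_p_scaled: "real m powr \<alpha> \<le> 15 / 4 * real (p_5_16 m)"
proof -
  have "m < 5 ^ m" by (rule power_gt_expt) simp
  then have "(real m + 1) powr \<alpha> \<le> 15 / 4 * real (p_5_16 m) + 1" by (rule powr_le_p)
  moreover have "real m powr \<alpha> + 1 powr \<alpha> \<le> (real m + 1) powr \<alpha>"
    by (rule powr_superadditive) (use \<alpha>_ge_1 in simp_all)
  ultimately show ?thesis by simp
qed
theorem theorem10:
  shows
    "(\<forall>n::nat. n \<ge> 2 \<longrightarrow>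
        (47 * real n + 140) / 176 \<le> real (p_5_16 (nat (f_5_0 n))) \<and>
        real (p_5_16 (nat (f_5_0 n))) \<le> (15 * real n - 11) / 4)
     \<and> (\<forall>n::nat.
        real (p_5_16 (nat (f_5_0 n))) = (47 * real n + 140) / 176
          \<longleftrightarrow> base_rep 16 n \<in> star {[11]} \<cdot> {[12]})
     \<and> (\<forall>n::nat.
        real (p_5_16 (nat (f_5_0 n))) = (15 * real n - 11) / 4
          \<longleftrightarrow> base_rep 16 n \<in> {[1], [5]} \<union> {[4]} \<cdot> star {[4]} \<cdot> {[5]})
     \<and> (\<forall>n::nat. n \<ge> 2 \<longrightarrow>
        ((47 * real n + 140) / 176) powr (ln 5 / ln 16) \<le> real_of_int (f_5_0 n) \<and>
        real_of_int (f_5_0 n) \<le> ((225 * real n - 165) / 16) powr (ln 5 / ln 16))"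
proof (intro conjI allI impI)
  have p_real: "real (p_5_16 (nat (f_5_0 n))) = of_int (p_int (f_5_0 n))" for n
    by (simp add: p_int_def)
  have lower_eq: "real (p_5_16 (nat (f_5_0 n))) = (47 * real n + 140) / 176 \<longleftrightarrow>
      176 * p_int (f_5_0 n) = 47 * int n + 140" for n
    unfolding p_real of_int_eq_iff[where ?'a = real, symmetric] by (auto simp: field_simps)
  have upper_eq: "real (p_5_16 (nat (f_5_0 n))) = (15 * real n - 11) / 4 \<longleftrightarrow>
      4 * p_int (f_5_0 n) = 15 * int n - 11" for n
    unfolding p_real of_int_eq_iff[where ?'a = real, symmetric] by (auto simp: field_simps)
  have lower: "(47 * real n + 140) / 176 \<le> real (p_5_16 (nat (f_5_0 n)))" if "2 \<le> n" for n
  proof -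
    have "47 * int n + 140 \<le> 176 * p_int (f_5_0 n)" using f_lower[of n] that by simp
    then show ?thesis
      unfolding p_real of_int_le_iff[where ?'a = real, symmetric] by (simp add: field_simps)
  qed
  have upper: "real (p_5_16 (nat (f_5_0 n))) \<le> (15 * real n - 11) / 4" if "2 \<le> n" for n
  proof -
    have "4 * p_int (f_5_0 n) \<le> 15 * int n - 11" using f_upper[of n] that by simp
    then show ?thesis
      unfolding p_real of_int_le_iff[where ?'a = real, symmetric] by (simp add: field_simps)
  qed
  have inverse_\<alpha>: "ln 5 / ln 16 = 1 / \<alpha>" "\<alpha> > 0" by (simp_all add: \<alpha>_def)
  have f_real: "real (nat (f_5_0 n)) = real_of_int (f_5_0 n)" "real_of_int (f_5_0 n) > 0"
    if "2 \<le> n" for n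
    using f_pos[of n] that by simp_all
  fix n :: nat
  show "real (p_5_16 (nat (f_5_0 n))) = (47 * real n + 140) / 176 \<longleftrightarrow>
      base_rep 16 n \<in> star {[11]} \<cdot> {[12]}"
    unfolding lower_eq lower_language
  proof
    assume eq: "176 * p_int (f_5_0 n) = 47 * int n + 140"
    \<comment> \<open>The equivalence is claimed for all \<open>n\<close>, but
      \<open>f_lower\<close> starts at 2: the sides are 0 and 140 at 0, and 176 and 187 at
      1.\<close>
    have "n \<noteq> 0" "n \<noteq> 1" by (rule notI; use eq in \<open>simp add: p_int_small\<close>)+
    then show "\<exists>k. n = Suc (repdigit 11 (Suc k))" using f_lower[of n] eq by auto
  next
    assume "\<exists>k. n = Suc (repdigit 11 (Suc k))"
    then show "176 * p_int (f_5_0 n) = 47 * int n + 140" using f_lower_attained by blast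
  qed
  show "real (p_5_16 (nat (f_5_0 n))) = (15 * real n - 11) / 4 \<longleftrightarrow>
      base_rep 16 n \<in> {[1], [5]} \<union> {[4]} \<cdot> star {[4]} \<cdot> {[5]}"
    unfolding upper_eq upper_language
  proof
    assume eq: "4 * p_int (f_5_0 n) = 15 * int n - 11"
    have "n \<noteq> 0" by (rule notI; use eq in \<open>simp add: p_int_small\<close>)
    then show "\<exists>k. n = Suc (repdigit 4 k)" using f_upper[of n] eq by auto
  next
    assume "\<exists>k. n = Suc (repdigit 4 k)"
    then show "4 * p_int (f_5_0 n) = 15 * int n - 11" using f_upper_attained by blast
  qed
  assume n: "2 \<le> n"
  show "(47 * real n + 140) / 176 \<le> real (p_5_16 (nat (f_5_0 n)))" by (rule lower[OF n])
  show "real (p_5_16 (nat (f_5_0 n))) \<le> (15 * real n - 11) / 4" by (rule upper[OF n])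
  have root: "(real_of_int (f_5_0 n) powr \<alpha>) powr (1 / \<alpha>) = real_of_int (f_5_0 n)"
    using f_real[OF n] inverse_\<alpha> by (simp add: powr_powr)
  have "(47 * real n + 140) / 176 \<le> real_of_int (f_5_0 n) powr \<alpha>"
    using lower[OF n] p_le_powr[of "nat (f_5_0 n)"] f_real(1)[OF n] by simp
  then have "((47 * real n + 140) / 176) powr (1 / \<alpha>) \<le> (real_of_int (f_5_0 n) powr \<alpha>) powr (1 / \<alpha>)"
    using inverse_\<alpha> by (intro powr_mono2) simp_all
  then show "((47 * real n + 140) / 176) powr (ln 5 / ln 16) \<le> real_of_int (f_5_0 n)"
    unfolding root inverse_\<alpha>(1) .
  \<comment> \<open>The constants are 15/4 times those of the linear upper bound.\<close>
  have "real_of_int (f_5_0 n) powr \<alpha> \<le> (225 * real n - 165) / 16"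
    using upper[OF n] powr_le_p_scaled[of "nat (f_5_0 n)"] f_real(1)[OF n] by simp
  then have "(real_of_int (f_5_0 n) powr \<alpha>) powr (1 / \<alpha>) \<le> ((225 * real n - 165) / 16) powr (1 / \<alpha>)"
    using inverse_\<alpha> by (intro powr_mono2) simp_all
  then show "real_of_int (f_5_0 n) \<le> ((225 * real n - 165) / 16) powr (ln 5 / ln 16)"
    unfolding root inverse_\<alpha>(1) .
qed

end
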